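(* Let $\mathbb{F}$ be an arbitrary field and $A\in\mathbb{F}^{m\times n}$. Let $I\subset\{1,\dots,m\}$, $J\subset\{1,\dots,n\}$, $C=A(:,J)$, $R=A(I,:)$, and $U=A(I,J)$. Let $B=A(I,J^c)$, $D=A(I^c,J)$ and $E=A(I^c,J^c)$, so that after rearranging rows and columns $A=\begin{bmatrix} U & B\\ D& E\end{bmatrix}$. The following are equivalent: (i) $\operatorname{rank}(U)=\operatorname{rank}(A)$; (ii) $\operatorname{rank}(C)=\operatorname{rank}(R)=\operatorname{rank}(A)$; (iii) $A=CU^\sim R$ for some generalized inverse $U^\sim$ of $U$; (iv) $A=CU^\sim R$ for all generalized inverses $U^\sim$ of $U$; (v) $A=CC^\sim AR^\sim R$ for some generalized inverses $C^\sim$ of $C$ and $R^\sim$ of $R$; (vi) $A=CC^\sim AR^\sim R$ for all generalized inverses $C^\sim$ of $C$ and $R^\sim$ of $R$; (vii) for some generalized inverses $C^\sim$ of $C$ and $R^\sim$ of $R$, $R^\sim UC^\sim$ is a generalized inverse of $A$; (viii) for all generalized inverses $C^\sim$ of $C$ and $R^\sim$ of $R$, $R^\sim UC^\sim$ is a generalized inverse of $A$; (ix) there is a generalized inverse $U^\sim$ of $U$ such that $E-DU^\sim B=0$, $D(I-U^\sim U)=0$ and $(I-UU^\sim)B=0$ (here $I$ denotes an identity matrix); (x) for all generalized inverses $U_1^\sim,U_2^\sim,U_3^\sim$ of $U$ such that $U_1^\sim=U_2^\sim$ or $U_1^\sim=U_3^\sim$, one has $E-DU_1^\sim B=0$, $D(I-U_2^\sim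 U)=0$ and $(I-UU_3^\sim)B=0$ (here $I$ denotes an identity matrix).
   Context: For $A\in\mathbb{F}^{m\times n}$ and index sets $I\subset\{1,\dots,m\}$, $J\subset\{1,\dots,n\}$: $A(I,:)$ is the $|I|\times n$ submatrix of rows indexed by $I$, $A(:,J)$ is the $m\times|J|$ submatrix of columns indexed by $J$, and $A(I,J)$ is the $|I|\times|J|$ submatrix of entries with row index in $I$ and column index in $J$. $I^c$ and $J^c$ are the complements in $\{1,\dots,m\}$ and $\{1,\dots,n\}$. A generalized inverse of a matrix $M\in\mathbb{F}^{p\times q}$ is any matrix $M^\sim\in\mathbb{F}^{q\times p}$ with $MM^\sim M=M$. The matrix $E-DU^\sim B$ is the generalized Schur complement $A/U$ of $A$ with respect to $U$ (for the chosen $U^\sim$). *)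

theory Defs
  imports
    "Jordan_Normal_Form.DL_Rank"
    "Jordan_Normal_Form.DL_Submatrix"
begin

text \<open>
  Rows and columns of an \<open>m \<times> n\<close> matrix are numbered from \<open>0\<close>, so index sets are subsets of
  \<open>{..<m}\<close> and \<open>{..<n}\<close>. In \<^term>\<open>submatrix A I J\<close> the selected rows and columns appear in
  increasing order, and the index set \<^term>\<open>UNIV\<close> plays the role of the colon in \<open>A(I,:)\<close>
  and \<open>A(:,J)\<close>. Matrices with no rows or no columns are allowed.
\<close>

text \<open>
  \<^const>\<open>vec_space.rank\<close> is the dimension of the column span; its first argument is the dimension
  of the ambient space of the columns.
\<close>
abbreviation mrank :: "'a::field mat \<Rightarrow> nat" where
  "mrank A \<equiv> vec_space.rank (dim_row A) A"

definition generalized_inverse :: "'a::field mat \<Rightarrow> 'a mat \<Rightarrow> bool" where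
  "generalized_inverse M G \<longleftrightarrow> G \<in> carrier_mat (dim_col M) (dim_row M) \<and> M * G * M = M"

end

theory Submission
  imports Defs
begin

text \<open>
  Every condition is equivalent to one fact: the columns of \<open>C\<close> span the column space of \<open>A\<close> and the
  rows of \<open>R\<close> span its row space, that is, \<open>A = C Y = X R\<close> for some matrices \<open>X\<close> and \<open>Y\<close>. Write
  \<open>R = S A\<close>, \<open>C = A T\<close> and \<open>U = S A T\<close> with 0-1 selection matrices \<open>S\<close> and \<open>T\<close>. Then \<open>C = X U\<close>,
  \<open>R = U Y\<close> and \<open>A = X U Y\<close>. The last equation gives the rank of \<open>U\<close>, and for any generalized inverse
  \<open>G\<close> of \<open>U\<close> one gets \<open>C G R = X (U G U) Y = A\<close>. Also \<open>C C'\<close> and \<open>R' R\<close> fix \<open>A\<close> from the left and the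
  right, which yields \<open>A = C C' A R' R\<close> and, using \<open>U = R T\<close>, that \<open>R' U C'\<close> is a generalized inverse
  of \<open>A\<close>.

  Conversely, \<open>A = C G R\<close> and \<open>A = C C' A R' R\<close> exhibit \<open>A\<close> as a left multiple of \<open>R\<close> and a right
  multiple of \<open>C\<close>, and \<open>A = A R' U C' A\<close> bounds the rank of \<open>A\<close> by that of \<open>U\<close>. The step from ranks back
  to factors is the equality case of the rank inequality: if \<open>A T\<close> has the rank of \<open>A\<close>, then \<open>A\<close> is a
  right multiple of \<open>A T\<close> (\<open>mrank_mult_right_eqD\<close>), and dually by transposition. The Schur complement
  equations are the equation \<open>A = C G R\<close> read block by block (\<open>CUR_iff_schur_conditions\<close>).

  All facts about rank come from one consequence of Gauss-Jordan elimination
  (\<open>ex_split_factorization\<close>): \<open>M = F H\<close> where \<open>F\<close> has a left inverse \<open>L\<close> and \<open>H\<close> a right inverse \<open>K\<close>.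
  The inner dimension is the rank, and \<open>K L\<close> is a generalized inverse of \<open>M\<close>.
\<close>

section \<open>Full rank factorizations\<close>

text \<open>
  In \<open>assoc_mult_mat\<close> the dimensions do not occur in the equation and cannot be found by rewriting;
  side conditions on \<^const>\<open>dim_row\<close> and \<^const>\<open>dim_col\<close> make associativity a rewrite rule.
\<close>

lemma mult_mat_assoc_dim:
  fixes X Y Z :: "'a::semiring_0 mat"
  assumes "dim_col X = dim_row Y" and "dim_col Y = dim_row Z"
  shows "X * Y * Z = X * (Y * Z)"
  using assms by (intro assoc_mult_mat) auto

text \<open>
  Gauss-Jordan elimination writes \<open>M = Q N\<close> with \<open>Q\<close> invertible (inverse \<open>P\<close>) and \<open>N\<close> in reduced
  row echelon form. Only the first \<open>r\<close> rows of \<open>N\<close> are nonzero, so \<open>M\<close> is also the product of the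
  first \<open>r\<close> columns of \<open>Q\<close> and the first \<open>r\<close> rows of \<open>N\<close>. The first \<open>r\<close> rows of \<open>P\<close> are a left
  inverse of the former, and the 0-1 matrix selecting the pivot columns is a right inverse of the
  latter.
\<close>

lemma ex_split_factorization:
  fixes M :: "'a::field mat"
  assumes M: "M \<in> carrier_mat p q"
  obtains r F H L K where
    "F \<in> carrier_mat p r" "H \<in> carrier_mat r q" "L \<in> carrier_mat r p" "K \<in> carrier_mat q r"
    "M = F * H" "L * F = 1\<^sub>m r" "H * K = 1\<^sub>m r"
proof -
  define N where "N = gauss_jordan_single M"
  note gj = gauss_jordan_single[OF M N_def[symmetric]]
  have N: "N \<in> carrier_mat p q" by (rule gj(2))
  obtain P Q where NP: "N = P * M" and P: "P \<in> carrier_mat p p" and Q: "Q \<in> carrier_mat p p"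
    and PQ: "P * Q = 1\<^sub>m p" and QP: "Q * P = 1\<^sub>m p"
    using gj(4) by blast
  have "Q * N = Q * P * M" unfolding NP using Q P M by (simp add: assoc_mult_mat[of _ p p _ p])
  then have MQN: "M = Q * N" unfolding QP using M by simp
  obtain f where f: "pivot_fun N f q"
    using gj(3) N unfolding row_echelon_form_def by auto
  have dN: "dim_row N = p" using N by simp
  note pf = pivot_funD[OF dN f]
  \<comment> \<open>The pivot function takes the value \<open>q\<close> exactly on the zero rows, and these come last.\<close>
  define r where "r = (LEAST i. i \<ge> p \<or> f i = q)"
  have r_le: "r \<le> p" unfolding r_def by (rule Least_le) simp
  have pivot: "f i < q" if "i < r" for i
  proof -
    have "\<not> (i \<ge> p \<or> f i = q)" using not_less_Least[of i] that unfolding r_def by blast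
    with pf(1)[of i] show ?thesis by auto
  qed
  have stop: "f i = q" if "r \<le> i" "i < p" for i
    using that
  proof (induction i rule: dec_induct)
    case base
    have "r \<ge> p \<or> f r = q" unfolding r_def by (rule LeastI[of _ p]) simp
    with base show ?case by simp
  next
    case (step i)
    then show ?case using pf(1)[of "Suc i"] pf(3)[of i] by auto
  qed
  have zero: "N $$ (i, j) = 0" if "r \<le> i" "i < p" "j < q" for i j
    using pf(2)[of i j] stop[of i] that by simp
  define F where "F = mat p r (\<lambda>(i,j). Q $$ (i,j))"
  define H where "H = mat r q (\<lambda>(i,j). N $$ (i,j))"
  define L where "L = mat r p (\<lambda>(i,j). P $$ (i,j))"
  define K where "K = mat q r (\<lambda>(i,j). if i = f j then 1 else 0 :: 'a)"
  have "M = F * H"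
  proof (rule eq_matI)
    fix i j assume "i < dim_row (F * H)" "j < dim_col (F * H)"
    then have ij: "i < p" "j < q" by (auto simp: F_def H_def)
    have "M $$ (i,j) = (\<Sum>k\<in>{0..<p}. Q $$ (i,k) * N $$ (k,j))"
      unfolding MQN using ij Q N by (simp add: scalar_prod_def)
    also have "\<dots> = (\<Sum>k\<in>{0..<r}. Q $$ (i,k) * N $$ (k,j))"
      by (rule sum.mono_neutral_right) (use r_le zero ij in auto)
    also have "\<dots> = (F * H) $$ (i,j)"
      using ij by (simp add: F_def H_def scalar_prod_def)
    finally show "M $$ (i,j) = (F * H) $$ (i,j)" .
  qed (use M in \<open>auto simp: F_def H_def\<close>)
  moreover have "L * F = 1\<^sub>m r"
  proof (rule eq_matI)
    fix i j assume "i < dim_row (1\<^sub>m r)" "j < dim_col (1\<^sub>m r)"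
    then have ij: "i < r" "j < r" by auto
    then have "(L * F) $$ (i,j) = (P * Q) $$ (i,j)"
      using P Q r_le by (simp add: F_def L_def scalar_prod_def)
    then show "(L * F) $$ (i,j) = 1\<^sub>m r $$ (i,j)" unfolding PQ using ij r_le by simp
  qed (auto simp: F_def L_def)
  moreover have "H * K = 1\<^sub>m r"
  proof (rule eq_matI)
    fix i j assume "i < dim_row (1\<^sub>m r)" "j < dim_col (1\<^sub>m r)"
    then have ij: "i < r" "j < r" by auto
    then have "(H * K) $$ (i,j) = (\<Sum>k\<in>{0..<q}. if k = f j then N $$ (i,k) else 0)"
      by (simp add: H_def K_def scalar_prod_def if_distrib cong: if_cong)
    also have "\<dots> = N $$ (i, f j)" using pivot[of j] ij by simp
    also have "\<dots> = 1\<^sub>m r $$ (i,j)"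
      using pf(4)[of j] pf(5)[of j i] pivot[of j] ij r_le by auto
    finally show "(H * K) $$ (i,j) = 1\<^sub>m r $$ (i,j)" .
  qed (auto simp: H_def K_def)
  ultimately show thesis
    by (intro that[of F r H L K]) (auto simp: F_def H_def L_def K_def)
qed

text \<open>
  The right inverse \<open>K\<close> makes the column space of \<open>F * H\<close> equal to that of \<open>F\<close>, and the left inverse
  \<open>L\<close> makes the \<open>r\<close> columns of \<open>F\<close> linearly independent. So the inner dimension of any such
  factorization is the rank, and every rank argument below becomes matrix algebra.
\<close>

lemma mrank_split_factorization:
  fixes F H L K :: "'a::field mat"
  assumes F: "F \<in> carrier_mat p r" and H: "H \<in> carrier_mat r q"
    and L: "L \<in> carrier_mat r p" and K: "K \<in> carrier_mat q r"
    and LF: "L * F = 1\<^sub>m r" and HK: "H * K = 1\<^sub>m r"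
  shows "mrank (F * H) = r"
proof -
  interpret vec_space "TYPE('a)" p .
  have inj: "v = w" if "v \<in> carrier_vec r" "w \<in> carrier_vec r" "F *\<^sub>v v = F *\<^sub>v w" for v w
  proof -
    have "L * F *\<^sub>v v = L * F *\<^sub>v w" using that F L by simp
    then show ?thesis using that LF by simp
  qed
  have "distinct (cols F)"
  proof (subst distinct_conv_nth, intro allI impI notI)
    fix i j assume ij: "i < length (cols F)" "j < length (cols F)" "i \<noteq> j" "cols F ! i = cols F ! j"
    then have "col (L * F) i = col (L * F) j" using F L by simp
    then show False unfolding LF using ij F by (auto dest: arg_cong[of _ _ "\<lambda>v. v $ i"])
  qed
  moreover have "lin_indpt (set (cols F))"
  proof
    assume "lin_dep (set (cols F))"
    from lin_depE[OF F this \<open>distinct (cols F)\<close>]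
    obtain v where "v \<in> carrier_vec r" "v \<noteq> 0\<^sub>v r" "F *\<^sub>v v = 0\<^sub>v p" by blast
    moreover have "F *\<^sub>v 0\<^sub>v r = 0\<^sub>v p" using F by (intro eq_vecI) auto
    ultimately show False using inj[of v "0\<^sub>v r"] by simp
  qed
  ultimately have "rank F = r" using lin_indpt_full_rank[OF F] by blast
  moreover have "col_space (F * H) = col_space F"
  proof -
    have FH: "F * H \<in> carrier_mat p q" using F H by simp
    have "(\<exists>x\<in>carrier_vec q. (F * H) *\<^sub>v x = y) \<longleftrightarrow> (\<exists>x\<in>carrier_vec r. F *\<^sub>v x = y)" for y
    proof
      assume "\<exists>x\<in>carrier_vec q. (F * H) *\<^sub>v x = y"
      then show "\<exists>x\<in>carrier_vec r. F *\<^sub>v x = y" using F H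
        by (metis assoc_mult_mat_vec mult_mat_vec_carrier)
    next
      assume "\<exists>x\<in>carrier_vec r. F *\<^sub>v x = y"
      then obtain x where x: "x \<in> carrier_vec r" "F *\<^sub>v x = y" by blast
      have "(F * H) *\<^sub>v (K *\<^sub>v x) = F *\<^sub>v ((H * K) *\<^sub>v x)" using F H K x by simp
      then have "(F * H) *\<^sub>v (K *\<^sub>v x) = y" using HK x by simp
      then show "\<exists>x\<in>carrier_vec q. (F * H) *\<^sub>v x = y" using K x by (metis mult_mat_vec_carrier)
    qed
    then show ?thesis using col_space_eq[OF FH] col_space_eq[OF F] F H by simp
  qed
  ultimately have "rank (F * H) = r" unfolding rank_def col_space_def by simp
  then show ?thesis using F by simp
qed

text \<open>
  The columns of \<open>P\<close> span a space of dimension \<open>r\<close>, because \<open>y = P (Q y)\<close> for every \<open>y\<close>.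
\<close>

lemma right_invertible_imp_rows_le_cols:
  fixes P Q :: "'a::field mat"
  assumes P: "P \<in> carrier_mat r s" and Q: "Q \<in> carrier_mat s r" and PQ: "P * Q = 1\<^sub>m r"
  shows "r \<le> s"
proof -
  interpret vec_space "TYPE('a)" r .
  have "col_space P = carrier_vec r"
  proof -
    have "\<exists>x\<in>carrier_vec s. P *\<^sub>v x = y" if "y \<in> carrier_vec r" for y
    proof
      show "P *\<^sub>v (Q *\<^sub>v y) = y" using assoc_mult_mat_vec[OF P Q that] PQ that by simp
      show "Q *\<^sub>v y \<in> carrier_vec s" using Q that by simp
    qed
    then show ?thesis using col_space_eq[OF P] P by auto
  qed
  then have "dim \<le> card (set (cols P))"
    using P cols_dim[of P] by (intro gen_ge_dim) (auto simp: col_space_def)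
  also have "\<dots> \<le> s" using card_length[of "cols P"] P by simp
  finally show ?thesis unfolding dim_is_n .
qed

section \<open>Rank inequalities and their equality cases\<close>

lemma ex_full_rank_factorization:
  fixes M :: "'a::field mat"
  assumes M: "M \<in> carrier_mat p q"
  obtains F H L K where
    "F \<in> carrier_mat p (mrank M)" "H \<in> carrier_mat (mrank M) q"
    "L \<in> carrier_mat (mrank M) p" "K \<in> carrier_mat q (mrank M)"
    "M = F * H" "L * F = 1\<^sub>m (mrank M)" "H * K = 1\<^sub>m (mrank M)"
proof -
  obtain r F H L K where fac: "F \<in> carrier_mat p r" "H \<in> carrier_mat r q"
    "L \<in> carrier_mat r p" "K \<in> carrier_mat q r"
    "M = F * H" "L * F = 1\<^sub>m r" "H * K = 1\<^sub>m r"
    using ex_split_factorization[OF M] .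
  then have r: "mrank M = r" using mrank_split_factorization[of F p r H q L K] by simp
  show thesis using that[unfolded r, OF fac] .
qed

text \<open>
  Cancelling the outer factors of a full rank factorization of \<open>X * Y\<close> turns it into a factorization
  of an identity matrix through dimension \<open>s\<close>.
\<close>

lemma mrank_mult_le_inner_dim:
  fixes X Y :: "'a::field mat"
  assumes X: "X \<in> carrier_mat p s" and Y: "Y \<in> carrier_mat s q"
  shows "mrank (X * Y) \<le> s"
proof -
  have XY: "X * Y \<in> carrier_mat p q" using X Y by simp
  obtain F H L K where fac: "F \<in> carrier_mat p (mrank (X * Y))" "H \<in> carrier_mat (mrank (X * Y)) q"
    "L \<in> carrier_mat (mrank (X * Y)) p" "K \<in> carrier_mat q (mrank (X * Y))"
    "X * Y = F * H" "L * F = 1\<^sub>m (mrank (X * Y))" "H * K = 1\<^sub>m (mrank (X * Y))"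
    using ex_full_rank_factorization[OF XY] .
  have "(L * X) * (Y * K) = L * (X * Y) * K"
    using X Y fac(3,4) by (simp add: mult_mat_assoc_dim)
  also have "\<dots> = (L * F) * (H * K)"
    using fac(1-4) unfolding fac(5) by (simp add: mult_mat_assoc_dim)
  also have "\<dots> = 1\<^sub>m (mrank (X * Y))" using fac(6,7) by simp
  finally show ?thesis
    using X Y fac(3,4) by (intro right_invertible_imp_rows_le_cols[of "L * X" _ _ "Y * K"]) auto
qed

text \<open>
  Row rank equals column rank: the transpose of a split factorization is a split factorization with
  the same inner dimension.
\<close>

lemma mrank_transpose:
  fixes M :: "'a::field mat"
  shows "mrank M\<^sup>T = mrank M"
proof -
  obtain p q where M: "M \<in> carrier_mat p q" by blast
  define r where "r = mrank M"
  obtain F H L K where fac: "F \<in> carrier_mat p r" "H \<in> carrier_mat r q"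
    "L \<in> carrier_mat r p" "K \<in> carrier_mat q r"
    "M = F * H" "L * F = 1\<^sub>m r" "H * K = 1\<^sub>m r"
    using ex_full_rank_factorization[OF M] unfolding r_def[symmetric] .
  have "F\<^sup>T * L\<^sup>T = 1\<^sub>m r" "K\<^sup>T * H\<^sup>T = 1\<^sub>m r"
    unfolding transpose_mult[OF fac(3,1), symmetric] transpose_mult[OF fac(2,4), symmetric] fac(6,7)
    by simp_all
  then have "mrank (H\<^sup>T * F\<^sup>T) = r"
    using fac(1-4) by (intro mrank_split_factorization[of _ q _ _ p "K\<^sup>T" "L\<^sup>T"]) auto
  then show ?thesis using transpose_mult[OF fac(1,2)] fac(5) r_def by simp
qed

lemma mrank_mult_le:
  fixes X Y :: "'a::field mat"
  assumes X: "X \<in> carrier_mat p s" and Y: "Y \<in> carrier_mat s q"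
  shows mrank_mult_le_left: "mrank (X * Y) \<le> mrank X"
    and mrank_mult_le_right: "mrank (X * Y) \<le> mrank Y"
proof -
  obtain F H L K where fac: "F \<in> carrier_mat p (mrank X)" "H \<in> carrier_mat (mrank X) s" "X = F * H"
    using ex_full_rank_factorization[OF X] by metis
  have "X * Y = F * (H * Y)" using fac Y by (metis assoc_mult_mat)
  then show "mrank (X * Y) \<le> mrank X"
    using mrank_mult_le_inner_dim[OF fac(1), of "H * Y" q] fac(2) Y by simp
next
  obtain F H L K where fac: "F \<in> carrier_mat s (mrank Y)" "H \<in> carrier_mat (mrank Y) q" "Y = F * H"
    using ex_full_rank_factorization[OF Y] by metis
  have "X * Y = (X * F) * H" using fac X by (metis assoc_mult_mat)
  then show "mrank (X * Y) \<le> mrank Y"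
    using mrank_mult_le_inner_dim[OF _ fac(2), of "X * F" p] fac(1) X by simp
qed

text \<open>
  If multiplication by \<open>T\<close> does not lower the rank, then \<open>A * T\<close> has the same column space as \<open>A\<close>,
  which is the existence of \<open>Y\<close>. In terms of factorizations \<open>A = F H\<close> and \<open>A T = F' H'\<close> with the same
  inner dimension \<open>r\<close>: one has \<open>F' = F W\<close> for a square \<open>W\<close>, which \<open>L' F\<close> inverts, hence
  \<open>A = F' L' A\<close>, and \<open>F' = A T K'\<close>.
\<close>

lemma mrank_mult_right_eqD:
  fixes A T :: "'a::field mat"
  assumes A: "A \<in> carrier_mat m n" and T: "T \<in> carrier_mat n l"
    and eq: "mrank (A * T) = mrank A"
  shows "\<exists>Y\<in>carrier_mat l n. A = A * T * Y"
proof -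
  define r where "r = mrank A"
  obtain F H L K where A_fac: "F \<in> carrier_mat m r" "H \<in> carrier_mat r n"
    "L \<in> carrier_mat r m" "K \<in> carrier_mat n r" "A = F * H" "L * F = 1\<^sub>m r" "H * K = 1\<^sub>m r"
    using ex_full_rank_factorization[OF A] unfolding r_def[symmetric] .
  have AT: "A * T \<in> carrier_mat m l" using A T by simp
  obtain F' H' L' K' where AT_fac: "F' \<in> carrier_mat m r" "H' \<in> carrier_mat r l"
    "L' \<in> carrier_mat r m" "K' \<in> carrier_mat l r"
    "A * T = F' * H'" "L' * F' = 1\<^sub>m r" "H' * K' = 1\<^sub>m r"
    using ex_full_rank_factorization[OF AT] unfolding eq r_def[symmetric] .
  define W where "W = H * T * K'"
  have W: "W \<in> carrier_mat r r" using A_fac(2) T AT_fac(4) by (simp add: W_def)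
  have ATK: "A * T * K' = F'"
    unfolding AT_fac(5) using AT_fac(1,2,4,7) by (simp add: assoc_mult_mat[of _ m r])
  have "F * W = A * T * K'"
    unfolding W_def A_fac(5) using A_fac(1,2) T AT_fac(4) by (simp add: mult_mat_assoc_dim)
  then have FW: "F * W = F'" unfolding ATK .
  \<comment> \<open>A one-sided inverse of a square matrix is two-sided; this is where the ranks being equal is used.\<close>
  have "(L' * F) * W = 1\<^sub>m r"
    using A_fac(1) AT_fac(3,6) W FW by (simp add: assoc_mult_mat[of _ r m])
  then have inv: "W * (L' * F) = 1\<^sub>m r"
    using mat_mult_left_right_inverse[of "L' * F" r W] A_fac(1) AT_fac(3) W by simp
  have "A * T * (K' * L' * A) = (A * T * K') * (L' * A)"
    using A T AT_fac(3,4) by (simp add: mult_mat_assoc_dim)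
  also have "A * T * K' = F * W" unfolding FW ATK ..
  also have "F * W * (L' * A) = F * (W * (L' * F)) * H"
    using A_fac(1,2) AT_fac(3) W by (simp add: mult_mat_assoc_dim A_fac(5))
  also have "\<dots> = A" unfolding inv A_fac(5) using A_fac(1) by simp
  finally have "A = A * T * (K' * L' * A)" by simp
  moreover have "K' * L' * A \<in> carrier_mat l n" using A AT_fac(3,4) by simp
  ultimately show ?thesis by blast
qed

lemma mrank_mult_left_eqD:
  fixes A S :: "'a::field mat"
  assumes A: "A \<in> carrier_mat m n" and S: "S \<in> carrier_mat k m"
    and eq: "mrank (S * A) = mrank A"
  shows "\<exists>X\<in>carrier_mat m k. A = X * (S * A)"
proof -
  have "mrank (A\<^sup>T * S\<^sup>T) = mrank A\<^sup>T"
    using eq transpose_mult[OF S A] by (metis mrank_transpose)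
  then obtain Y where Y: "Y \<in> carrier_mat k m" "A\<^sup>T = A\<^sup>T * S\<^sup>T * Y"
    using mrank_mult_right_eqD[of "A\<^sup>T" n m "S\<^sup>T" k] A S by auto
  have "A = (A\<^sup>T * S\<^sup>T * Y)\<^sup>T" using Y(2) by (metis transpose_transpose)
  also have "\<dots> = Y\<^sup>T * (S * A)"
    unfolding transpose_mult[OF S A, symmetric]
    using A S Y(1) transpose_mult[of "(S * A)\<^sup>T" n k Y m] by simp
  finally show ?thesis using Y(1) by auto
qed

section \<open>Generalized inverses\<close>

text \<open>
  If \<open>M = F H\<close> with \<open>L F = 1\<close> and \<open>H K = 1\<close>, then \<open>K L\<close> is a generalized inverse. Existence is what
  turns each statement about all generalized inverses into one about some.
\<close>

lemma ex_generalized_inverse: "\<exists>G. generalized_inverse M G"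
proof -
  obtain p q where M: "M \<in> carrier_mat p q" by blast
  obtain r F H L K where fac: "F \<in> carrier_mat p r" "H \<in> carrier_mat r q"
    "L \<in> carrier_mat r p" "K \<in> carrier_mat q r"
    "M = F * H" "L * F = 1\<^sub>m r" "H * K = 1\<^sub>m r"
    using ex_split_factorization[OF M] .
  have "M * (K * L) * M = F * (H * K) * (L * F) * H"
    using fac(1-4) by (simp add: fac(5) mult_mat_assoc_dim)
  also have "\<dots> = M" unfolding fac(6,7) using fac(1,2,5) by simp
  finally show ?thesis
    using M fac(3,4) unfolding generalized_inverse_def by (intro exI[of _ "K * L"]) auto
qed

text \<open>
  \<open>C * G\<close> is a projection onto the column space of \<open>C\<close>, hence fixes every matrix whose columns lie there;
  dually, \<open>G * R\<close> acts as the identity from the right on matrices with rows in the row space of \<open>R\<close>.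
\<close>

lemma generalized_inverse_left_absorb:
  assumes "generalized_inverse C G" and "Y \<in> carrier_mat (dim_col C) n" and "Z = C * Y"
  shows "C * G * Z = Z"
proof -
  have G: "G \<in> carrier_mat (dim_col C) (dim_row C)" and CGC: "C * G * C = C"
    using assms(1) unfolding generalized_inverse_def by auto
  have "C * G * Z = C * G * C * Y"
    unfolding assms(3) using G assms(2) by (simp add: mult_mat_assoc_dim)
  then show ?thesis unfolding CGC assms(3) .
qed

lemma generalized_inverse_right_absorb:
  assumes "generalized_inverse R G" and "X \<in> carrier_mat m (dim_row R)" and "Z = X * R"
  shows "Z * G * R = Z"
proof -
  have G: "G \<in> carrier_mat (dim_col R) (dim_row R)" and RGR: "R * G * R = R"
    using assms(1) unfolding generalized_inverse_def by auto
  have "Z * G * R = X * (R * G * R)"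
    unfolding assms(3) using G assms(2) by (simp add: mult_mat_assoc_dim)
  then show ?thesis unfolding RGR assms(3) .
qed

section \<open>Compressions of a matrix by left and right multipliers\<close>

text \<open>
  Selecting rows and columns is multiplication by 0-1 matrices from the left and from the right. The
  equivalences that do not mention the complementary blocks hold for arbitrary multipliers \<open>S\<close> and \<open>T\<close>.
\<close>

locale matrix_compression =
  fixes A S T C R U :: "'a::field mat" and m n k l :: nat
  assumes A: "A \<in> carrier_mat m n" and S: "S \<in> carrier_mat k m" and T: "T \<in> carrier_mat n l"
    and C_eq: "C = A * T" and R_eq: "R = S * A" and U_eq: "U = S * A * T"
begin

lemma C: "C \<in> carrier_mat m l" and R: "R \<in> carrier_mat k n" and U: "U \<in> carrier_mat k l"
  using A S T by (simp_all add: C_eq R_eq U_eq)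

lemma U_eq_SC: "U = S * C" and U_eq_RT: "U = R * T"
  using A S T by (simp_all add: C_eq R_eq U_eq mult_mat_assoc_dim)

text \<open>
  The columns of \<open>C\<close> span the column space of \<open>A\<close> and the rows of \<open>R\<close> its row space, in a form fit for
  matrix algebra. It is the hub through which the other conditions are compared.
\<close>

definition cross_spans :: bool where
  "cross_spans \<longleftrightarrow>
     (\<exists>X\<in>carrier_mat m k. \<exists>Y\<in>carrier_mat l n. A = C * Y \<and> A = X * R)"

lemma cross_ranks_iff_cross_spans:
  "mrank C = mrank A \<and> mrank R = mrank A \<longleftrightarrow> cross_spans"
proof
  assume ranks: "mrank C = mrank A \<and> mrank R = mrank A"
  obtain Y where "Y \<in> carrier_mat l n" "A = C * Y"
    using mrank_mult_right_eqD[OF A T, folded C_eq, OF conjunct1[OF ranks]] by (elim bexE)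
  moreover obtain X where "X \<in> carrier_mat m k" "A = X * R"
    using mrank_mult_left_eqD[OF A S, folded R_eq, OF conjunct2[OF ranks]] by (elim bexE)
  ultimately show cross_spans
    unfolding cross_spans_def by (intro bexI conjI)
next
  assume cross_spans
  then obtain X Y where X: "X \<in> carrier_mat m k" and Y: "Y \<in> carrier_mat l n"
    and CY: "A = C * Y" and XR: "A = X * R"
    unfolding cross_spans_def by blast
  have "mrank A \<le> mrank C" "mrank A \<le> mrank R"
    using mrank_mult_le_left[OF C Y] mrank_mult_le_right[OF X R]
    unfolding CY[symmetric] XR[symmetric] .
  then show "mrank C = mrank A \<and> mrank R = mrank A"
    using mrank_mult_le_left[OF A T] mrank_mult_le_right[OF S A] unfolding C_eq R_eq by simp
qed

text \<open>
  Multiplying \<open>A = X R\<close> by \<open>T\<close> gives \<open>C = X U\<close>, multiplying \<open>A = C Y\<close> by \<open>S\<close> gives \<open>R = U Y\<close>: everything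
  passes through the core \<open>U\<close>, which therefore has the full rank of \<open>A\<close>.
\<close>

lemma cross_spansE:
  assumes cross_spans
  obtains X Y where "X \<in> carrier_mat m k" and "Y \<in> carrier_mat l n"
    and "A = C * Y" and "A = X * R" and "C = X * U" and "R = U * Y" and "A = X * U * Y"
proof -
  obtain X Y where X: "X \<in> carrier_mat m k" and Y: "Y \<in> carrier_mat l n"
    and CY: "A = C * Y" and XR: "A = X * R"
    using assms unfolding cross_spans_def by blast
  have "X * U = X * R * T" unfolding U_eq_RT using X R T by simp
  then have CXU: "C = X * U" unfolding XR[symmetric] C_eq ..
  have "U * Y = S * (C * Y)" unfolding U_eq_SC using S C Y by simp
  then have RUY: "R = U * Y" unfolding CY[symmetric] R_eq ..
  have "A = X * U * Y" unfolding CXU[symmetric] by (rule CY)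
  then show thesis using that[OF X Y CY XR CXU RUY] by blast
qed

lemma mrank_chain: "mrank U \<le> mrank C" "mrank U \<le> mrank R" "mrank C \<le> mrank A" "mrank R \<le> mrank A"
  using mrank_mult_le_right[OF S C] mrank_mult_le_left[OF R T]
    mrank_mult_le_left[OF A T] mrank_mult_le_right[OF S A]
  unfolding U_eq_SC[symmetric] U_eq_RT[symmetric] C_eq[symmetric] R_eq[symmetric] .

lemma mrank_U_eq_iff_le: "mrank U = mrank A \<longleftrightarrow> mrank A \<le> mrank U"
  using mrank_chain by linarith

lemma rank_iff_cross_spans: "mrank U = mrank A \<longleftrightarrow> cross_spans"
proof
  assume "mrank U = mrank A"
  then have "mrank C = mrank A \<and> mrank R = mrank A" using mrank_chain by linarith
  then show cross_spans unfolding cross_ranks_iff_cross_spans .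
next
  assume cross_spans
  then obtain X Y where X: "X \<in> carrier_mat m k" and Y: "Y \<in> carrier_mat l n" and XUY: "A = X * U * Y"
    by (rule cross_spansE)
  have "mrank (X * U * Y) \<le> mrank (X * U)"
    using X Y U by (intro mrank_mult_le_left[of _ m l _ n]) auto
  also have "\<dots> \<le> mrank U" using X U by (rule mrank_mult_le_right)
  finally show "mrank U = mrank A" unfolding mrank_U_eq_iff_le XUY[symmetric] .
qed

text \<open>
  With \<open>C = X U\<close> and \<open>R = U Y\<close> the product \<open>C G R\<close> is \<open>X (U G U) Y\<close>, which does not depend on the choice of \<open>G\<close>.
\<close>

lemma cross_spans_imp_CUR:
  assumes cross_spans and G: "generalized_inverse U G"
  shows "A = C * G * R"
proof -
  obtain X Y where X: "X \<in> carrier_mat m k" and Y: "Y \<in> carrier_mat l n"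
    and CXU: "C = X * U" and RUY: "R = U * Y" and XUY: "A = X * U * Y"
    using assms(1) by (rule cross_spansE)
  have G': "G \<in> carrier_mat l k" and UGU: "U * G * U = U"
    using G U unfolding generalized_inverse_def by auto
  have "C * G * R = X * (U * G * U) * Y"
    unfolding CXU RUY using X Y U G' by (simp add: mult_mat_assoc_dim)
  then show ?thesis unfolding UGU XUY[symmetric] by simp
qed

lemma CUR_imp_cross_spans:
  assumes G: "G \<in> carrier_mat l k" and eq: "A = C * G * R"
  shows cross_spans
  unfolding cross_spans_def
proof (intro bexI conjI)
  show "A = C * (G * R)" using eq C G R by simp
  show "A = C * G * R" by (rule eq)
qed (use C G R in auto)

lemma cross_spans_imp_projections_fix:
  assumes cross_spans and C': "generalized_inverse C C'" and R': "generalized_inverse R R'"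
  shows "C * C' * A = A" and "A * R' * R = A"
proof -
  obtain X Y where X: "X \<in> carrier_mat m k" and Y: "Y \<in> carrier_mat l n"
    and CY: "A = C * Y" and XR: "A = X * R"
    using assms(1) by (rule cross_spansE)
  show "C * C' * A = A"
    using C Y by (intro generalized_inverse_left_absorb[OF C' _ CY]) auto
  show "A * R' * R = A"
    using R X by (intro generalized_inverse_right_absorb[OF R' _ XR]) auto
qed

lemma projections_fix_imp_cross_spans:
  assumes C': "C' \<in> carrier_mat l m" and R': "R' \<in> carrier_mat n k" and eq: "A = C * C' * A * R' * R"
  shows cross_spans
  unfolding cross_spans_def
proof (intro bexI conjI)
  show "A = C * (C' * A * R' * R)"
    by (subst eq) (use A C R C' R' in \<open>simp add: mult_mat_assoc_dim\<close>)
  show "A = (C * C' * A * R') * R" by (rule eq)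
qed (use A C R C' R' in auto)

text \<open>
  Since \<open>U = R T\<close>, the product \<open>A R' U C' A\<close> is \<open>(A R' R) T C' A = A T C' A = C C' A = A\<close>.
\<close>

lemma cross_spans_imp_generalized_inverse:
  assumes sp: cross_spans and C': "generalized_inverse C C'" and R': "generalized_inverse R R'"
  shows "generalized_inverse A (R' * U * C')"
proof -
  have C'c: "C' \<in> carrier_mat l m" and R'c: "R' \<in> carrier_mat n k"
    using C' R' C R unfolding generalized_inverse_def by auto
  note fixed = cross_spans_imp_projections_fix[OF assms]
  have "A * (R' * U * C') * A = (A * R' * R) * T * C' * A"
    unfolding U_eq_RT using A R T C'c R'c by (simp add: mult_mat_assoc_dim)
  also have "\<dots> = C * C' * A" unfolding fixed C_eq ..
  also have "\<dots> = A" by (rule fixed)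
  finally show ?thesis using A U C'c R'c unfolding generalized_inverse_def by auto
qed

text \<open>
  \<open>A = A R' U C' A\<close> factors through \<open>U\<close>, so \<open>U\<close> cannot have smaller rank than \<open>A\<close>.
\<close>

lemma generalized_inverse_imp_cross_spans:
  assumes C': "C' \<in> carrier_mat l m" and R': "R' \<in> carrier_mat n k"
    and inv: "generalized_inverse A (R' * U * C')"
  shows cross_spans
proof -
  have "(A * R') * (U * (C' * A)) = A"
    using inv A U C' R' unfolding generalized_inverse_def by (simp add: mult_mat_assoc_dim)
  moreover have "mrank ((A * R') * (U * (C' * A))) \<le> mrank (U * (C' * A))"
    using A U C' R' by (intro mrank_mult_le_right[of _ m k _ n]) auto
  moreover have "mrank (U * (C' * A)) \<le> mrank U"
    using A U C' by (intro mrank_mult_le_left[of _ k l _ n]) auto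
  ultimately show ?thesis unfolding rank_iff_cross_spans[symmetric] mrank_U_eq_iff_le by simp
qed

end

section \<open>Submatrices and block decompositions\<close>

lemma submatrix_mult:
  assumes "dim_col X = dim_row Y"
  shows "submatrix (X * Y) I J = submatrix X I UNIV * submatrix Y UNIV J"
proof (rule eq_matI)
  fix i j assume ij: "i < dim_row (submatrix X I UNIV * submatrix Y UNIV J)"
    "j < dim_col (submatrix X I UNIV * submatrix Y UNIV J)"
  then show "submatrix (X * Y) I J $$ (i, j) = (submatrix X I UNIV * submatrix Y UNIV J) $$ (i, j)"
    using assms by (simp add: dim_submatrix submatrix_index pick_le pick_UNIV scalar_prod_def)
qed (simp_all add: dim_submatrix)

lemma submatrix_UNIV_UNIV: "submatrix X UNIV UNIV = X"
  by (rule eq_matI) (simp_all add: dim_submatrix submatrix_index pick_UNIV)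

lemma submatrix_rows_submatrix_cols:
  "submatrix (submatrix X UNIV J) I UNIV = submatrix X I J"
  by (rule submatrix_split[symmetric])

lemma submatrix_cols_submatrix_rows:
  "submatrix (submatrix X I UNIV) UNIV J = submatrix X I J"
  by (rule eq_matI) (simp_all add: dim_submatrix submatrix_index pick_UNIV pick_le)

lemma submatrix_eq_imp_index_eq:
  assumes "submatrix X I J = submatrix Y I J"
    and "X \<in> carrier_mat m n" and "Y \<in> carrier_mat m n"
    and "i < m" "j < n" "i \<in> I" "j \<in> J"
  shows "X $$ (i, j) = Y $$ (i, j)"
  using assms submatrix_index_card[of i X j I J] submatrix_index_card[of i Y j I J] by simp

lemma eq_mat_iff_blocks:
  assumes X: "X \<in> carrier_mat m n" and Y: "Y \<in> carrier_mat m n"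
  shows "X = Y \<longleftrightarrow>
    submatrix X I J = submatrix Y I J \<and>
    submatrix X I ({..<n} - J) = submatrix Y I ({..<n} - J) \<and>
    submatrix X ({..<m} - I) J = submatrix Y ({..<m} - I) J \<and>
    submatrix X ({..<m} - I) ({..<n} - J) = submatrix Y ({..<m} - I) ({..<n} - J)"
    (is "_ \<longleftrightarrow> ?blocks")
proof
  assume blocks: ?blocks
  show "X = Y"
  proof (rule eq_matI)
    fix i j assume "i < dim_row Y" "j < dim_col Y"
    then have ij: "i < m" "j < n" using Y by auto
    note same = submatrix_eq_imp_index_eq[OF _ X Y ij]
    show "X $$ (i, j) = Y $$ (i, j)"
      using ij blocks same[of I J] same[of I "{..<n} - J"] same[of "{..<m} - I" J]
        same[of "{..<m} - I" "{..<n} - J"]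
      by (cases "i \<in> I"; cases "j \<in> J") simp_all
  qed (use X Y in auto)
qed simp

lemma minus_eq_zero_mat_iff:
  fixes X Y :: "'a::field mat"
  assumes X: "X \<in> carrier_mat p q" and Y: "Y \<in> carrier_mat p q"
  shows "X - Y = 0\<^sub>m p q \<longleftrightarrow> X = Y"
proof
  assume diff: "X - Y = 0\<^sub>m p q"
  show "X = Y"
  proof (rule eq_matI)
    fix i j assume ij: "i < dim_row Y" "j < dim_col Y"
    then have "(X - Y) $$ (i, j) = 0" using diff Y by simp
    then show "X $$ (i, j) = Y $$ (i, j)" using ij by simp
  qed (use X Y in auto)
qed (use Y in auto)

lemma submatrix_carrier_mat:
  assumes "X \<in> carrier_mat m n" and "I \<subseteq> {..<m}" and "J \<subseteq> {..<n}"
  shows "submatrix X I J \<in> carrier_mat (card I) (card J)"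
    and "submatrix X I UNIV \<in> carrier_mat (card I) n"
    and "submatrix X UNIV J \<in> carrier_mat m (card J)"
proof -
  have index_sets: "{i. i < m \<and> i \<in> I} = I" "{j. j < n \<and> j \<in> J} = J" using assms(2,3) by auto
  have "dim_row X = m" "dim_col X = n" using assms(1) by simp_all
  then show "submatrix X I J \<in> carrier_mat (card I) (card J)"
    "submatrix X I UNIV \<in> carrier_mat (card I) n"
    "submatrix X UNIV J \<in> carrier_mat m (card J)"
    unfolding carrier_mat_def by (simp_all add: dim_submatrix index_sets)
qed

lemma submatrix_CGR:
  assumes A: "A \<in> carrier_mat m n" and I: "I \<subseteq> {..<m}" and J: "J \<subseteq> {..<n}"
    and G: "G \<in> carrier_mat (card J) (card I)"
  shows "submatrix (submatrix A UNIV J * G * submatrix A I UNIV) I' J'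
    = submatrix A I' J * G * submatrix A I J'"
proof -
  note C = submatrix_carrier_mat(3)[OF A I J] and R = submatrix_carrier_mat(2)[OF A I J]
  have "submatrix (submatrix A UNIV J * G * submatrix A I UNIV) I' J'
    = submatrix (submatrix A UNIV J * G) I' UNIV * submatrix (submatrix A I UNIV) UNIV J'"
    using G R by (intro submatrix_mult) simp
  also have "submatrix (submatrix A UNIV J * G) I' UNIV
    = submatrix (submatrix A UNIV J) I' UNIV * submatrix G UNIV UNIV"
    using C G by (intro submatrix_mult) simp
  finally show ?thesis
    unfolding submatrix_UNIV_UNIV submatrix_rows_submatrix_cols submatrix_cols_submatrix_rows .
qed

text \<open>
  Compare \<open>A\<close> with \<open>C G R\<close> on the four blocks cut out by \<open>I\<close>, \<open>J\<close> and their complements. The blocks of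
  \<open>C G R\<close> are \<open>U G U\<close>, \<open>U G B\<close>, \<open>D G U\<close> and \<open>D G B\<close>; the first always agrees with \<open>U\<close>, and the other three
  agreements are the three Schur complement equations.
\<close>

lemma CUR_iff_schur_conditions:
  fixes A G :: "'a::field mat"
  assumes A: "A \<in> carrier_mat m n" and I: "I \<subseteq> {..<m}" and J: "J \<subseteq> {..<n}"
    and U_eq: "U = submatrix A I J"
    and B_eq: "B = submatrix A I ({..<n} - J)"
    and D_eq: "D = submatrix A ({..<m} - I) J"
    and E_eq: "E = submatrix A ({..<m} - I) ({..<n} - J)"
    and inv: "generalized_inverse U G"
  shows "A = submatrix A UNIV J * G * submatrix A I UNIV \<longleftrightarrow>
    E - D * G * B = 0\<^sub>m (card ({..<m} - I)) (card ({..<n} - J)) \<and>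
    D * (1\<^sub>m (card J) - G * U) = 0\<^sub>m (card ({..<m} - I)) (card J) \<and>
    (1\<^sub>m (card I) - U * G) * B = 0\<^sub>m (card I) (card ({..<n} - J))"
proof -
  have subs: "{..<m} - I \<subseteq> {..<m}" "{..<n} - J \<subseteq> {..<n}" by auto
  have U: "U \<in> carrier_mat (card I) (card J)"
    and B: "B \<in> carrier_mat (card I) (card ({..<n} - J))"
    and D: "D \<in> carrier_mat (card ({..<m} - I)) (card J)"
    and E: "E \<in> carrier_mat (card ({..<m} - I)) (card ({..<n} - J))"
    using submatrix_carrier_mat(1)[OF A] I J subs by (simp_all add: U_eq B_eq D_eq E_eq)
  have G: "G \<in> carrier_mat (card J) (card I)" and UGU: "U * G * U = U"
    using inv U unfolding generalized_inverse_def by auto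
  have CGR: "submatrix A UNIV J * G * submatrix A I UNIV \<in> carrier_mat m n"
    using submatrix_carrier_mat(2,3)[OF A I J] G by auto
  have "D * (1\<^sub>m (card J) - G * U) = D - D * G * U"
    using D G U mult_minus_distrib_mat[OF D one_carrier_mat, of "G * U"] by simp
  moreover have "D * G * U \<in> carrier_mat (card ({..<m} - I)) (card J)" using D G U by simp
  ultimately have eqD: "D * (1\<^sub>m (card J) - G * U) = 0\<^sub>m (card ({..<m} - I)) (card J) \<longleftrightarrow> D = D * G * U"
    using D minus_eq_zero_mat_iff by simp
  have "(1\<^sub>m (card I) - U * G) * B = B - U * G * B"
    using B G U minus_mult_distrib_mat[OF one_carrier_mat, of "U * G" "card I" B] by simp
  moreover have "U * G * B \<in> carrier_mat (card I) (card ({..<n} - J))" using B G U by simp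
  ultimately have eqB: "(1\<^sub>m (card I) - U * G) * B = 0\<^sub>m (card I) (card ({..<n} - J)) \<longleftrightarrow> B = U * G * B"
    using B minus_eq_zero_mat_iff by simp
  have "D * G * B \<in> carrier_mat (card ({..<m} - I)) (card ({..<n} - J))" using B G D by simp
  then have eqE: "E - D * G * B = 0\<^sub>m (card ({..<m} - I)) (card ({..<n} - J)) \<longleftrightarrow> E = D * G * B"
    using E minus_eq_zero_mat_iff by blast
  show ?thesis
    unfolding eq_mat_iff_blocks[OF A CGR, of I J] submatrix_CGR[OF A I J G]
      U_eq[symmetric] B_eq[symmetric] D_eq[symmetric] E_eq[symmetric] eqB eqD eqE UGU
    by blast
qed

text \<open>
  The selecting multipliers are the corresponding submatrices of identity matrices.
\<close>

lemma matrix_compression_submatrix: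
  fixes A :: "'a::field mat"
  assumes A: "A \<in> carrier_mat m n" and I: "I \<subseteq> {..<m}" and J: "J \<subseteq> {..<n}"
  shows "matrix_compression A (submatrix (1\<^sub>m m) I UNIV) (submatrix (1\<^sub>m n) UNIV J)
    (submatrix A UNIV J) (submatrix A I UNIV) (submatrix A I J) m n (card I) (card J)"
proof
  show "A \<in> carrier_mat m n" by (rule A)
  show "submatrix (1\<^sub>m m) I UNIV \<in> carrier_mat (card I) m"
    using I by (intro submatrix_carrier_mat(2)) auto
  show "submatrix (1\<^sub>m n) UNIV J \<in> carrier_mat n (card J)"
    using J by (intro submatrix_carrier_mat(3)) auto
  have SA: "submatrix (1\<^sub>m m) I UNIV * A = submatrix A I UNIV"
    using submatrix_mult[of "1\<^sub>m m" A I UNIV] A by (simp add: submatrix_UNIV_UNIV)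
  have AT: "X * submatrix (1\<^sub>m n) UNIV J = submatrix X UNIV J" if "dim_col X = n" for X :: "'a mat"
    using submatrix_mult[of X "1\<^sub>m n" UNIV J] that
    by (simp add: submatrix_UNIV_UNIV right_mult_one_mat')
  show "submatrix A UNIV J = A * submatrix (1\<^sub>m n) UNIV J" using AT A by simp
  show "submatrix A I UNIV = submatrix (1\<^sub>m m) I UNIV * A" using SA by simp
  have "dim_col (submatrix A I UNIV) = n" using submatrix_carrier_mat(2)[OF A I J] by simp
  then show "submatrix A I J = submatrix (1\<^sub>m m) I UNIV * A * submatrix (1\<^sub>m n) UNIV J"
    unfolding SA by (simp add: AT submatrix_cols_submatrix_rows)
qed

section \<open>The equivalences\<close>

theorem theorem3p1:
  fixes A C R U B D E :: "'a::field mat"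
    and m n :: nat
    and I J :: "nat set"
  assumes "A \<in> carrier_mat m n"
    and "I \<subseteq> {..<m}" and "J \<subseteq> {..<n}"
    and "C = submatrix A UNIV J"
    and "R = submatrix A I UNIV"
    and "U = submatrix A I J"
    and "B = submatrix A I ({..<n} - J)"
    and "D = submatrix A ({..<m} - I) J"
    and "E = submatrix A ({..<m} - I) ({..<n} - J)"
  shows
    "(mrank U = mrank A \<longleftrightarrow>
        mrank C = mrank A \<and> mrank R = mrank A) \<and>
     (mrank U = mrank A \<longleftrightarrow>
        (\<exists>G. generalized_inverse U G \<and> A = C * G * R)) \<and>
     (mrank U = mrank A \<longleftrightarrow>
        (\<forall>G. generalized_inverse U G \<longrightarrow> A = C * G * R)) \<and>
     (mrank U = mrank A \<longleftrightarrow>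
        (\<exists>C' R'. generalized_inverse C C' \<and> generalized_inverse R R' \<and>
           A = C * C' * A * R' * R)) \<and>
     (mrank U = mrank A \<longleftrightarrow>
        (\<forall>C' R'. generalized_inverse C C' \<and> generalized_inverse R R' \<longrightarrow>
           A = C * C' * A * R' * R)) \<and>
     (mrank U = mrank A \<longleftrightarrow>
        (\<exists>C' R'. generalized_inverse C C' \<and> generalized_inverse R R' \<and>
           generalized_inverse A (R' * U * C'))) \<and>
     (mrank U = mrank A \<longleftrightarrow>
        (\<forall>C' R'. generalized_inverse C C' \<and> generalized_inverse R R' \<longrightarrow>
           generalized_inverse A (R' * U * C'))) \<and>
     (mrank U = mrank A \<longleftrightarrow>
        (\<exists>G. generalized_inverse U G \<and>
           E - D * G * B = 0\<^sub>m (card ({..<m} - I)) (card ({..<n} - J)) \<and>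
           D * (1\<^sub>m (card J) - G * U) = 0\<^sub>m (card ({..<m} - I)) (card J) \<and>
           (1\<^sub>m (card I) - U * G) * B = 0\<^sub>m (card I) (card ({..<n} - J)))) \<and>
     (mrank U = mrank A \<longleftrightarrow>
        (\<forall>G1 G2 G3. generalized_inverse U G1 \<and> generalized_inverse U G2 \<and>
           generalized_inverse U G3 \<and> (G1 = G2 \<or> G1 = G3) \<longrightarrow>
           E - D * G1 * B = 0\<^sub>m (card ({..<m} - I)) (card ({..<n} - J)) \<and>
           D * (1\<^sub>m (card J) - G2 * U) = 0\<^sub>m (card ({..<m} - I)) (card J) \<and>
           (1\<^sub>m (card I) - U * G3) * B = 0\<^sub>m (card I) (card ({..<n} - J))))"
proof -
  interpret matrix_compression A "submatrix (1\<^sub>m m) I UNIV" "submatrix (1\<^sub>m n) UNIV J" C R U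
    m n "card I" "card J"
    using matrix_compression_submatrix[OF assms(1-3)] unfolding assms(4-6) .
  note schur = CUR_iff_schur_conditions[OF assms(1-3,6-9), folded assms(4,5)]
  have U_dim: "G \<in> carrier_mat (card J) (card I)" if "generalized_inverse U G" for G
    using that U unfolding generalized_inverse_def by simp
  have C_dim: "C' \<in> carrier_mat (card J) m" if "generalized_inverse C C'" for C'
    using that C unfolding generalized_inverse_def by simp
  have R_dim: "R' \<in> carrier_mat n (card I)" if "generalized_inverse R R'" for R'
    using that R unfolding generalized_inverse_def by simp
  obtain G0 C0 R0 where inv: "generalized_inverse U G0" "generalized_inverse C C0" "generalized_inverse R R0"
    using ex_generalized_inverse by blast
  define conditions where "conditions G1 G2 G3 \<longleftrightarrow>
      E - D * G1 * B = 0\<^sub>m (card ({..<m} - I)) (card ({..<n} - J)) \<and>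
      D * (1\<^sub>m (card J) - G2 * U) = 0\<^sub>m (card ({..<m} - I)) (card J) \<and>
      (1\<^sub>m (card I) - U * G3) * B = 0\<^sub>m (card I) (card ({..<n} - J))" for G1 G2 G3
  have cond: "conditions G G G \<longleftrightarrow> cross_spans" if "generalized_inverse U G" for G
    using schur[OF that] cross_spans_imp_CUR[OF _ that] CUR_imp_cross_spans[OF U_dim[OF that]]
    unfolding conditions_def by blast
  \<comment> \<open>Each of the three equations involves only one of the generalized inverses.\<close>
  have mixed: "conditions G1 G2 G3"
    if "conditions G1 G1 G1" "conditions G2 G2 G2" "conditions G3 G3 G3" for G1 G2 G3
    using that unfolding conditions_def by blast
  have CUR: "A = C * G * R \<longleftrightarrow> cross_spans" if "generalized_inverse U G" for G
    using cross_spans_imp_CUR[OF _ that] CUR_imp_cross_spans[OF U_dim[OF that]] by iprover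
  have proj: "A = C * C' * A * R' * R \<longleftrightarrow> cross_spans"
    if "generalized_inverse C C'" "generalized_inverse R R'" for C' R'
  proof
    assume cross_spans
    from cross_spans_imp_projections_fix[OF this that] show "A = C * C' * A * R' * R" by simp
  next
    assume "A = C * C' * A * R' * R"
    then show cross_spans by (rule projections_fix_imp_cross_spans[OF C_dim[OF that(1)] R_dim[OF that(2)]])
  qed
  have ginv: "generalized_inverse A (R' * U * C') \<longleftrightarrow> cross_spans"
    if "generalized_inverse C C'" "generalized_inverse R R'" for C' R'
    using cross_spans_imp_generalized_inverse[OF _ that]
      generalized_inverse_imp_cross_spans[OF C_dim[OF that(1)] R_dim[OF that(2)]] by iprover
  show ?thesis
    unfolding rank_iff_cross_spans conditions_def[symmetric]
  proof (intro conjI)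
    show "cross_spans \<longleftrightarrow> mrank C = mrank A \<and> mrank R = mrank A"
      unfolding cross_ranks_iff_cross_spans ..
    show "cross_spans \<longleftrightarrow> (\<exists>G. generalized_inverse U G \<and> A = C * G * R)"
      "cross_spans \<longleftrightarrow> (\<forall>G. generalized_inverse U G \<longrightarrow> A = C * G * R)"
      using CUR inv(1) by iprover+
    show "cross_spans \<longleftrightarrow> (\<exists>C' R'. generalized_inverse C C' \<and> generalized_inverse R R' \<and>
        A = C * C' * A * R' * R)"
      "cross_spans \<longleftrightarrow> (\<forall>C' R'. generalized_inverse C C' \<and> generalized_inverse R R' \<longrightarrow>
        A = C * C' * A * R' * R)"
      using proj inv(2,3) by iprover+
    show "cross_spans \<longleftrightarrow> (\<exists>C' R'. generalized_inverse C C' \<and> generalized_inverse R R' \<and>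
        generalized_inverse A (R' * U * C'))"
      "cross_spans \<longleftrightarrow> (\<forall>C' R'. generalized_inverse C C' \<and> generalized_inverse R R' \<longrightarrow>
        generalized_inverse A (R' * U * C'))"
      using ginv inv(2,3) by iprover+
    show "cross_spans \<longleftrightarrow> (\<exists>G. generalized_inverse U G \<and> conditions G G G)"
      using cond inv(1) by iprover
    show "cross_spans \<longleftrightarrow> (\<forall>G1 G2 G3. generalized_inverse U G1 \<and> generalized_inverse U G2 \<and>
        generalized_inverse U G3 \<and> (G1 = G2 \<or> G1 = G3) \<longrightarrow> conditions G1 G2 G3)"
    proof (intro iffI allI impI)
      fix G1 G2 G3
      assume cross_spans
        and "generalized_inverse U G1 \<and> generalized_inverse U G2 \<and>
          generalized_inverse U G3 \<and> (G1 = G2 \<or> G1 = G3)"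
      then have "conditions G1 G1 G1" "conditions G2 G2 G2" "conditions G3 G3 G3" using cond by simp_all
      then show "conditions G1 G2 G3" by (rule mixed)
    next
      assume "\<forall>G1 G2 G3. generalized_inverse U G1 \<and> generalized_inverse U G2 \<and>
          generalized_inverse U G3 \<and> (G1 = G2 \<or> G1 = G3) \<longrightarrow> conditions G1 G2 G3"
      then have "conditions G0 G0 G0" using inv(1) by simp
      then show cross_spans using cond inv(1) by simp
    qed
  qed
qed

end
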